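(* Let $\lambda>0$, $p,q\in[1,\infty]$, and $\mathcal{U}_{\sigma_q}=\{\boldsymbol\Delta\in\mathbb{R}^{m\times n}:\|\boldsymbol\Delta\|_{\sigma_q}\le\lambda\}$. For any $\mathbf{z}\in\mathbb{R}^m$ and $\boldsymbol\beta\in\mathbb{R}^n$, $$\max_{\boldsymbol\Delta\in\mathcal{U}_{\sigma_q}} \|\mathbf{z}+\boldsymbol\Delta\boldsymbol\beta\|_p \leq \|\mathbf{z}\|_p + \lambda\,\delta_m(p,2)\|\boldsymbol\beta\|_{2}.\qquad(\mathrm{UB})$$ In particular, if $p\in\{1,2,\infty\}$, there is equality in (UB) for all $(\mathbf{z},\boldsymbol\beta)$. If $p\notin\{1,2,\infty\}$ and $m\ge2$, then for any $\boldsymbol\beta\neq\mathbf{0}$ the inequality in (UB) is strict for almost all $\mathbf{z}$. Further, for $p\notin\{1,2,\infty\}$ one has, for all $\mathbf{z},\boldsymbol\beta$, the lower bound $$\|\mathbf{z}\|_p + \frac{\lambda}{\delta_m(2,p)}\|\boldsymbol\beta\|_{2}\leq\max_{\boldsymbol\Delta\in\mathcal{U}_{\sigma_q}} \|\mathbf{z}+\boldsymbol\Delta\boldsymbol\beta\|_p,$$ whose gap is arbitrarily small for all $\boldsymbol\beta$; that is, for every $\boldsymbol\beta\in\mathbb{R}^n$ the infimum over $\mathbf{z}\in\mathbb{R}^m$ of the right side minus the left side equals $0$.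
   Context: $\|\cdot\|_p$ is the $\ell_p$ norm. $\|\boldsymbol\Delta\|_{\sigma_q}$ is the Schatten norm, i.e. the $\ell_q$ norm of the vector of singular values of $\boldsymbol\Delta$. For $a,b\in[1,\infty]$, $\delta_m(a,b):=\max\{\|\mathbf{u}\|_a:\mathbf{u}\in\mathbb{R}^m,\ \|\mathbf{u}\|_b=1\}$. "Almost all" is with respect to Lebesgue measure on $\mathbb{R}^m$. *)

theory Defs
  imports "HOL-Analysis.Analysis"
begin

section \<open>Norms on coordinate vectors\<close>

definition lp_norm :: "ereal \<Rightarrow> real ^ 'k \<Rightarrow> real" where
  "lp_norm p x =
     (if p = \<infinity> then infnorm x
      else (\<Sum>i\<in>UNIV. \<bar>x $ i\<bar> powr real_of_ereal p) powr (1 / real_of_ereal p))"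

lemma lp_norm_two: "lp_norm 2 x = norm x"
proof -
  have "\<bar>x $ i\<bar> powr 2 = (x $ i)\<^sup>2" for i
    by (simp add: powr_numeral)
  moreover have "real_of_ereal 2 = 2"
    by simp
  ultimately show ?thesis
    unfolding lp_norm_def norm_vec_def L2_set_def
    by (simp add: powr_half_sqrt sum_nonneg)
qed

lemma lp_norm_infinity: "lp_norm \<infinity> x = Max (range (\<lambda>i. \<bar>x $ i\<bar>))"
proof -
  have "{\<bar>x $ i\<bar> |i. i \<in> UNIV} = range (\<lambda>i. \<bar>x $ i\<bar>)"
    by auto
  then show ?thesis
    by (simp add: lp_norm_def infnorm_cart cSup_eq_Max)
qed

text \<open>The dimension \<open>m\<close> is passed as a type argument, \<open>m = CARD('m)\<close>.\<close>

definition lp_ratio :: "'m::finite itself \<Rightarrow> ereal \<Rightarrow> ereal \<Rightarrow> real" where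
  "lp_ratio _ a b = Sup {lp_norm a u |u :: real ^ 'm. lp_norm b u = 1}"

lemma continuous_lp_norm:
  assumes "1 \<le> p"
  shows "continuous_on UNIV (lp_norm p :: real ^ 'k \<Rightarrow> real)"
proof (cases p)
  case (real r)
  with assms have r: "r \<ge> 1"
    by simp
  have "continuous_on UNIV
      (\<lambda>x::real^'k. (\<Sum>i\<in>UNIV. \<bar>x $ i\<bar> powr r) powr (1 / r))"
    using r by (intro continuous_on_powr' continuous_intros) (auto intro!: sum_nonneg)
  then show ?thesis
    using real by (simp add: lp_norm_def[abs_def])
next
  case PInf
  then show ?thesis
    by (simp add: lp_norm_def[abs_def] continuous_intros)
next
  case MInf
  with assms show ?thesis
    by simp
qed

lemma component_le_lp_norm:
  assumes "1 \<le> p"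
  shows "\<bar>x $ i\<bar> \<le> lp_norm p (x :: real ^ 'k)"
proof (cases p)
  case (real r)
  with assms have r: "r \<ge> 1"
    by simp
  have "\<bar>x $ i\<bar> = (\<bar>x $ i\<bar> powr r) powr (1 / r)"
    using r by (simp add: powr_powr)
  also have "\<dots> \<le> (\<Sum>j\<in>UNIV. \<bar>x $ j\<bar> powr r) powr (1 / r)"
    using r by (intro powr_mono2 member_le_sum) auto
  finally show ?thesis
    using real by (simp add: lp_norm_def)
next
  case PInf
  then show ?thesis
    by (simp add: lp_norm_def component_le_infnorm_cart)
next
  case MInf
  with assms show ?thesis
    by simp
qed

lemma lp_norm_axis:
  assumes "1 \<le> p"
  shows "lp_norm p (axis i 1 :: real ^ 'k) = 1"
proof (cases p)
  case (real r)
  with assms have r: "r \<ge> 1"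
    by simp
  have "(\<Sum>j\<in>UNIV. \<bar>axis i (1::real) $ j\<bar> powr r) = (\<Sum>j\<in>UNIV. if j = i then 1 else 0)"
    by (intro sum.cong) (auto simp: axis_def)
  then show ?thesis
    using real by (simp add: lp_norm_def)
next
  case PInf
  have "Max (range (\<lambda>j. \<bar>axis i (1::real) $ j\<bar>)) = 1"
    by (rule Max_eqI) (auto simp: axis_def image_iff)
  then show ?thesis
    using PInf by (simp add: lp_norm_infinity)
next
  case MInf
  with assms show ?thesis
    by simp
qed

text \<open>The supremum defining \<open>lp_ratio\<close> is a maximum.\<close>

lemma lp_ratio_attained:
  assumes "1 \<le> a" "1 \<le> b"
  obtains u :: "real ^ 'm::finite"
  where "lp_norm b u = 1" "lp_ratio TYPE('m) a b = lp_norm a u"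
    and "\<And>v :: real ^ 'm. lp_norm b v = 1 \<Longrightarrow> lp_norm a v \<le> lp_norm a u"
proof -
  let ?S = "{u :: real ^ 'm. lp_norm b u = 1}"
  have "closed (lp_norm b -` {1} :: (real ^ 'm) set)"
    by (rule closed_vimage[OF closed_singleton continuous_lp_norm[OF assms(2)]])
  then have "closed ?S"
    by (simp add: vimage_def)
  moreover have "bounded ?S"
  proof (rule boundedI)
    fix u assume "u \<in> ?S"
    then have "\<bar>u $ i\<bar> \<le> 1" for i
      using component_le_lp_norm[OF assms(2), of u i] by simp
    then have "(\<Sum>i\<in>UNIV. \<bar>u $ i\<bar>) \<le> (\<Sum>i\<in>(UNIV :: 'm set). 1)"
      by (intro sum_mono)
    then show "norm u \<le> real CARD('m)"
      using norm_le_l1_cart[of u] by simp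
  qed
  ultimately have "compact ?S"
    by (simp add: compact_eq_bounded_closed)
  moreover have "axis undefined 1 \<in> ?S"
    by (simp add: lp_norm_axis assms)
  then have "?S \<noteq> {}"
    by blast
  ultimately obtain u where u: "u \<in> ?S" "\<forall>v\<in>?S. lp_norm a v \<le> lp_norm a u"
    using continuous_attains_sup[OF _ _ continuous_on_subset[OF continuous_lp_norm[OF assms(1)]]]
    by blast
  have "lp_ratio TYPE('m) a b = lp_norm a u"
    unfolding lp_ratio_def using u by (intro cSup_eq_maximum) auto
  with u show ?thesis
    by (intro that[of u]) auto
qed


section \<open>Singular values and Schatten norms\<close>

text \<open>
  The singular values of \<open>A\<close> are the square roots of the eigenvalues of
  \<open>A\<^sup>T A\<close>, repeated according to multiplicity.  Here there are \<open>n = CARD('n)\<close> of them;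
  if \<open>n > m\<close>, this is the usual list of \<open>min m n\<close> singular values padded with zeros, which has
  the same \<open>\<ell>\<^sub>q\<close> norms.  The order of the entries is left open.
\<close>

definition is_singular_values :: "real ^ 'n ^ 'm \<Rightarrow> real ^ 'n \<Rightarrow> bool" where
  "is_singular_values A s \<longleftrightarrow>
     (\<forall>j. 0 \<le> s $ j) \<and>
     (\<forall>t\<ge>0. card {j. s $ j = t} = dim {v. (transpose A ** A) *v v = t\<^sup>2 *\<^sub>R v})"

definition singular_values :: "real ^ 'n ^ 'm \<Rightarrow> real ^ 'n" where
  "singular_values A = (SOME s. is_singular_values A s)"

definition schatten_norm :: "ereal \<Rightarrow> real ^ 'n ^ 'm \<Rightarrow> real" where
  "schatten_norm q A = lp_norm q (singular_values A)"

text \<open>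
  The choice above is well-defined: a vector of singular values exists (by the spectral theorem
  for \<open>A\<^sup>T A\<close>), and any two of them have the same \<open>\<ell>\<^sub>q\<close> norm.
\<close>

lemma selfadjoint_max_eigenvector:
  fixes f :: "'a::euclidean_space \<Rightarrow> 'a"
  assumes lin: "linear f" and sa: "\<And>x y. f x \<bullet> y = x \<bullet> f y"
    and V: "subspace V" "f ` V \<subseteq> V" "V \<noteq> {0}"
  obtains v c where "v \<in> V" "norm v = 1" "f v = c *\<^sub>R v"
proof -
  let ?S = "V \<inter> sphere 0 1"
  have "compact ?S"
    by (simp add: V closed_subspace closed_Int_compact)
  moreover obtain x where x: "x \<in> V" "x \<noteq> 0"
    using V subspace_0 by blast
  then have "x /\<^sub>R norm x \<in> ?S"
    using V by (simp add: subspace_scale)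
  then have "?S \<noteq> {}"
    by blast
  moreover have "continuous_on ?S (\<lambda>x. x \<bullet> f x)"
    by (intro continuous_intros linear_continuous_on linear_conv_bounded_linear[THEN iffD1] lin)
  ultimately obtain v where v: "v \<in> ?S" "\<And>y. y \<in> ?S \<Longrightarrow> y \<bullet> f y \<le> v \<bullet> f v"
    using continuous_attains_sup[of ?S "\<lambda>x. x \<bullet> f x"] by blast
  define c where "c = v \<bullet> f v"
  define Q where "Q x = c * (x \<bullet> x) - x \<bullet> f x" for x
  interpret f: linear f by (rule lin)
  have v1: "v \<in> V" "norm v = 1"
    using v by auto
  have Q: "Q x \<ge> 0" if "x \<in> V" for x
  proof (cases "x = 0")
    case False
    have "(x /\<^sub>R norm x) \<bullet> f (x /\<^sub>R norm x) \<le> c"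
      unfolding c_def using that False V by (intro v) (simp add: subspace_scale)
    then have "(x \<bullet> f x) / (norm x)\<^sup>2 \<le> c"
      by (simp add: f.scale power2_eq_square divide_inverse mult.commute mult.left_commute)
    then show ?thesis
      using False by (simp add: Q_def divide_le_eq dot_square_norm)
  qed (simp add: Q_def f.zero)
  define w where "w = c *\<^sub>R v - f v"
  have w: "w \<in> V"
    unfolding w_def using V v1 by (intro subspace_diff subspace_scale) auto
  have expand: "Q (v + t *\<^sub>R w) = 2 * t * (w \<bullet> w) + t\<^sup>2 * Q w" for t
  proof -
    have "v \<bullet> f w = w \<bullet> f v"
      using sa[of v w] by (simp add: inner_commute)
    moreover have "v \<bullet> v = 1"
      using v1 by (simp add: dot_square_norm)
    moreover have ww: "w \<bullet> w = c * (v \<bullet> w) - w \<bullet> f v"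
      by (subst (2) w_def) (simp add: inner_diff_right inner_commute)
    moreover have "t * (w \<bullet> w) = t * (c * (v \<bullet> w) - w \<bullet> f v)"
      unfolding ww ..
    ultimately show ?thesis
      unfolding Q_def f.add f.scale
      by (simp add: inner_add_left inner_add_right algebra_simps power2_eq_square
          inner_commute[of w v] c_def)
  qed
  have "w \<bullet> w = 0"
  proof (rule ccontr)
    assume "w \<bullet> w \<noteq> 0"
    then have ww: "w \<bullet> w > 0"
      using inner_ge_zero[of w] by linarith
    define t where "t = (w \<bullet> w) / (Q w + 1)"
    have Qw: "Q w \<ge> 0"
      using Q w by blast
    then have t: "t > 0"
      using ww by (simp add: t_def)
    have "0 \<le> Q (v + (- t) *\<^sub>R w)"
      using V v1 w by (intro Q subspace_add subspace_scale) auto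
    then have "t * (2 * (w \<bullet> w)) \<le> t * (t * Q w)"
      unfolding expand by (simp add: power2_eq_square algebra_simps)
    then have "2 * (w \<bullet> w) \<le> t * Q w"
      using t by simp
    also have "\<dots> \<le> t * (Q w + 1)"
      using t by simp
    also have "\<dots> = w \<bullet> w"
      using Qw by (simp add: t_def)
    finally show False
      using ww by simp
  qed
  then have "f v = c *\<^sub>R v"
    by (simp add: w_def)
  then show ?thesis
    using v1 that by blast
qed

lemma selfadjoint_eigenbasis:
  fixes f :: "'a::euclidean_space \<Rightarrow> 'a"
  assumes lin: "linear f" and sa: "\<And>x y. f x \<bullet> y = x \<bullet> f y"
    and "subspace V" "f ` V \<subseteq> V"
  shows "\<exists>B. B \<subseteq> V \<and> pairwise orthogonal B \<and> (\<forall>b\<in>B. norm b = 1 \<and> (\<exists>c. f b = c *\<^sub>R b)) \<and> span B = V"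
  using assms(3,4)
proof (induction "dim V" arbitrary: V rule: less_induct)
  case less
  show ?case
  proof (cases "V = {0}")
    case True
    then show ?thesis
      by (intro exI[of _ "{}"]) auto
  next
    case False
    obtain v c where v: "v \<in> V" "norm v = 1" "f v = c *\<^sub>R v"
      using selfadjoint_max_eigenvector[OF lin sa less.prems False] by blast
    define W where "W = V \<inter> {x. v \<bullet> x = 0}"
    have W: "subspace W"
      unfolding W_def by (intro subspace_inter less.prems subspace_hyperplane)
    have fW: "f ` W \<subseteq> W"
    proof
      fix y assume "y \<in> f ` W"
      then obtain x where x: "x \<in> W" "y = f x" by blast
      have "v \<bullet> f x = c * (v \<bullet> x)"
        using sa[of v x] v by simp
      then show "y \<in> W"
        using x less.prems by (auto simp: W_def)
    qed
    have "W \<subset> V"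
    proof -
      have "v \<notin> W"
        using v by (simp add: W_def dot_square_norm)
      moreover have "W \<subseteq> V"
        by (simp add: W_def)
      ultimately show ?thesis
        using v(1) by blast
    qed
    then have "dim W < dim V"
      by (metis W dim_psubset less.prems(1) span_eq_iff)
    from less.hyps[OF this W fW] obtain B where B: "B \<subseteq> W" "pairwise orthogonal B"
      "\<forall>b\<in>B. norm b = 1 \<and> (\<exists>c. f b = c *\<^sub>R b)" "span B = W"
      by blast
    have "span (insert v B) = V"
    proof
      show "span (insert v B) \<subseteq> V"
        using v B less.prems by (intro span_minimal) (auto simp: W_def)
      show "V \<subseteq> span (insert v B)"
      proof
        fix x assume x: "x \<in> V"
        have "x - (v \<bullet> x) *\<^sub>R v \<in> W"
          using x v less.prems
          by (auto simp: W_def subspace_diff subspace_scale inner_diff_right dot_square_norm)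
        then show "x \<in> span (insert v B)"
          unfolding span_insert B(4) by blast
      qed
    qed
    moreover have "pairwise orthogonal (insert v B)"
      using B by (auto simp: pairwise_insert W_def orthogonal_def inner_commute)
    ultimately show ?thesis
      using v B by (intro exI[of _ "insert v B"]) (auto simp: W_def)
  qed
qed

lemma ex_is_singular_values:
  fixes A :: "real ^ 'n ^ 'm"
  shows "\<exists>s. is_singular_values A s"
proof -
  define f where "f = (\<lambda>x. (transpose A ** A) *v x)"
  have inner_f: "f x \<bullet> y = (A *v x) \<bullet> (A *v y)" for x y
    unfolding f_def matrix_vector_mul_assoc[symmetric]
    by (metis dot_lmul_matrix vector_transpose_matrix transpose_transpose inner_commute)
  have lin: "linear f"
    unfolding f_def by (rule matrix_vector_mul_linear)
  have sa: "f x \<bullet> y = x \<bullet> f y" for x y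
    by (metis inner_f inner_commute)
  obtain B where B: "pairwise orthogonal B" "\<And>b. b \<in> B \<Longrightarrow> norm b = 1"
    "\<And>b. b \<in> B \<Longrightarrow> \<exists>c. f b = c *\<^sub>R b" "span B = UNIV"
    using selfadjoint_eigenbasis[OF lin sa subspace_UNIV] by auto
  define e where "e b = norm (A *v b)" for b
  have eig: "f b = (e b)\<^sup>2 *\<^sub>R b" if b: "b \<in> B" for b
  proof -
    obtain c where c: "f b = c *\<^sub>R b"
      using B(3)[OF b] by blast
    then have "c = (e b)\<^sup>2"
      using inner_f[of b b] B(2)[OF b] by (simp add: dot_square_norm e_def)
    with c show ?thesis
      by simp
  qed
  have "0 \<notin> B"
    using B(2) by force
  then have ind: "independent B"
    using B(1) pairwise_orthogonal_independent by blast
  then have fin: "finite B"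
    by (simp add: independent_imp_finite)
  have "card B = CARD('n)"
    using dim_span_eq_card_independent[OF ind] B(4) by (simp add: dim_UNIV)
  then obtain g :: "'n \<Rightarrow> real ^ 'n" where g: "bij_betw g UNIV B"
    using finite_same_card_bij[of "UNIV :: 'n set" B] fin by auto
  have gB: "g j \<in> B" for j
    using g by (auto simp: bij_betw_def)
  have dim: "dim {v. f v = t\<^sup>2 *\<^sub>R v} = card {b \<in> B. e b = t}" if t: "t \<ge> 0" for t
  proof -
    have e_iff: "(e b)\<^sup>2 = t\<^sup>2 \<longleftrightarrow> e b = t" for b
      using t by (simp add: e_def power2_eq_iff_nonneg)
    have "v \<in> span {b \<in> B. e b = t}" if v: "f v = t\<^sup>2 *\<^sub>R v" for v
    proof -
      have zero: "v \<bullet> b = 0" if "b \<in> B" "e b \<noteq> t" for b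
      proof -
        have "(e b)\<^sup>2 * (v \<bullet> b) = t\<^sup>2 * (v \<bullet> b)"
          using sa[of v b] v eig[OF that(1)] by auto
        then show ?thesis
          using that e_iff by auto
      qed
      have "v = (\<Sum>b\<in>B. (v \<bullet> b) *\<^sub>R b)"
      proof -
        let ?w = "v - (\<Sum>b\<in>B. (v \<bullet> b) *\<^sub>R b)"
        have "orthogonal ?w b" if "b \<in> B" for b
        proof -
          have "(\<Sum>a\<in>B. (v \<bullet> a) *\<^sub>R a) \<bullet> b = (\<Sum>a\<in>B. (v \<bullet> a) * (a \<bullet> b))"
            by (simp add: inner_sum_left)
          also have "\<dots> = (\<Sum>a\<in>B. if a = b then v \<bullet> b else 0)"
            using B(1,2) that
            by (intro sum.cong) (auto simp: pairwise_def orthogonal_def dot_square_norm)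
          also have "\<dots> = v \<bullet> b"
            using that fin by simp
          finally show ?thesis
            by (simp add: orthogonal_def inner_diff_left)
        qed
        then have "orthogonal ?w ?w"
          using orthogonal_to_span[of ?w B ?w] B(4) by blast
        then show ?thesis
          by (simp add: orthogonal_def)
      qed
      also have "\<dots> = (\<Sum>b\<in>{b \<in> B. e b = t}. (v \<bullet> b) *\<^sub>R b)"
        using fin zero by (intro sum.mono_neutral_right) auto
      also have "\<dots> \<in> span {b \<in> B. e b = t}"
        by (intro span_sum span_scale span_base)
      finally show ?thesis .
    qed
    moreover have "subspace {v. f v = t\<^sup>2 *\<^sub>R v}"
      using lin by (auto simp: subspace_def linear_0 linear_add linear_scale algebra_simps)
    then have "span {b \<in> B. e b = t} \<subseteq> {v. f v = t\<^sup>2 *\<^sub>R v}"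
      using eig by (intro span_minimal) auto
    ultimately have "{v. f v = t\<^sup>2 *\<^sub>R v} = span {b \<in> B. e b = t}"
      by blast
    then show ?thesis
      using independent_mono[OF ind, of "{b \<in> B. e b = t}"] by (simp add: dim_eq_card_independent)
  qed
  define s :: "real ^ 'n" where "s = (\<chi> j. e (g j))"
  have "card {j. s $ j = t} = card {b \<in> B. e b = t}" for t
  proof -
    have "bij_betw g {j. s $ j = t} {b \<in> B. e b = t}"
      using g by (auto simp: bij_betw_def s_def inj_on_def)
    then show ?thesis
      by (rule bij_betw_same_card)
  qed
  then have "is_singular_values A s"
    using dim unfolding is_singular_values_def f_def by (simp add: s_def e_def)
  then show ?thesis ..
qed

lemma is_singular_values_singular_values: "is_singular_values A (singular_values A)"
  unfolding singular_values_def by (rule someI_ex[OF ex_is_singular_values])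

lemma schatten_norm_eqI:
  fixes A :: "real ^ 'n ^ 'm"
  assumes s: "is_singular_values A s"
  shows "schatten_norm q A = lp_norm q s"
proof -
  let ?s = "singular_values A"
  note s' = is_singular_values_singular_values[of A]
  have card: "card {j. ?s $ j = t} = card {j. s $ j = t}" for t
  proof (cases "t \<ge> 0")
    case True
    then show ?thesis
      using s s' by (simp add: is_singular_values_def)
  next
    case False
    then have "{j. ?s $ j = t} = {}" "{j. s $ j = t} = {}"
      using s s' by (auto simp: is_singular_values_def)
    then show ?thesis
      by simp
  qed
  have range_iff: "t \<in> range (($) r) \<longleftrightarrow> card {j. r $ j = t} \<noteq> 0" for r :: "real ^ 'n" and t
    by auto
  have range: "range (($) ?s) = range (($) s)"
    by (intro set_eqI) (simp only: range_iff card)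
  have sum: "(\<Sum>j\<in>UNIV. h (r $ j)) = (\<Sum>t\<in>range (($) r). real (card {j. r $ j = t}) * h t)"
    for r :: "real ^ 'n" and h :: "real \<Rightarrow> real"
    by (subst sum.image_gen[of _ _ "($) r"]) (auto intro!: sum.cong)
  have power_sums: "(\<Sum>j\<in>UNIV. \<bar>?s $ j\<bar> powr r) = (\<Sum>j\<in>UNIV. \<bar>s $ j\<bar> powr r)" for r
    unfolding sum[where h = "\<lambda>x. \<bar>x\<bar> powr r"] range card ..
  moreover have "range (\<lambda>j. \<bar>?s $ j\<bar>) = range (\<lambda>j. \<bar>s $ j\<bar>)"
    using range by (metis image_image)
  ultimately show ?thesis
    unfolding schatten_norm_def by (cases "q = \<infinity>") (simp add: lp_norm_infinity, simp only: lp_norm_def if_False power_sums)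
qed


section \<open>Worst-case perturbation\<close>

definition schatten_ball :: "ereal \<Rightarrow> real \<Rightarrow> (real ^ 'n ^ 'm) set" where
  "schatten_ball q r = {D. schatten_norm q D \<le> r}"

definition worst_case :: "ereal \<Rightarrow> ereal \<Rightarrow> real \<Rightarrow> real ^ 'm \<Rightarrow> real ^ 'n \<Rightarrow> real" where
  "worst_case p q r z \<beta> =
     (SUP D \<in> (schatten_ball q r :: (real ^ 'n ^ 'm) set). lp_norm p (z + D *v \<beta>))"

end

theory Submission
  imports Defs
begin

text \<open>
  As \<open>D\<close> ranges over the Schatten ball, \<open>D \<beta>\<close> ranges over the Euclidean ball of radius
  \<open>R = \<lambda> \<parallel>\<beta>\<parallel>\<^sub>2\<close>, whatever \<open>q\<close> is: every Schatten norm dominates the operator norm and agrees with it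
  on matrices of rank one.  So the worst case is the maximum of \<open>\<parallel>z + w\<parallel>\<^sub>p\<close> over \<open>\<parallel>w\<parallel>\<^sub>2 \<le> R\<close>, and (UB) is
  Minkowski's inequality.  Equality for \<open>1 < p < \<infinity>\<close> forces \<open>w\<close> to be a multiple of \<open>z\<close>, so that \<open>z\<close>
  maximizes \<open>\<parallel>x\<parallel>\<^sub>p / \<parallel>x\<parallel>\<^sub>2\<close>; for \<open>p \<noteq> 2\<close> the nonzero coordinates of such a \<open>z\<close> have equal modulus, which
  is a null event.  The lower bound comes from taking \<open>w\<close> parallel to \<open>z\<close>.  Its gap tends to \<open>0\<close> along
  \<open>z = t u\<close>, \<open>t \<rightarrow> \<infinity>\<close>, where \<open>u\<close> maximizes \<open>\<parallel>x\<parallel>\<^sub>2 / \<parallel>x\<parallel>\<^sub>p\<close>, because the gradient of the \<open>\<ell>\<^sub>p\<close> norm at \<open>u\<close>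
  has Euclidean length \<open>1 / \<delta>\<^sub>m(2, p)\<close>.
\<close>

section \<open>Positivity and homogeneity of the l_p norm\<close>

lemma lp_norm_nonneg:
  assumes "1 \<le> p"
  shows "0 \<le> lp_norm p x"
  using component_le_lp_norm[OF assms, of x undefined] by (meson abs_ge_zero order_trans)

lemma lp_norm_eq_0:
  assumes "1 \<le> p" "lp_norm p x = 0"
  shows "x = 0"
  using component_le_lp_norm[OF assms(1), of x] assms(2) by (simp add: vec_eq_iff)

lemma lp_norm_pos:
  assumes "1 \<le> p" "x \<noteq> 0"
  shows "0 < lp_norm p x"
  using lp_norm_nonneg[OF assms(1), of x] lp_norm_eq_0[OF assms(1), of x] assms(2) by linarith

lemma lp_norm_scaleR:
  assumes "1 \<le> p"
  shows "lp_norm p (c *\<^sub>R x) = \<bar>c\<bar> * lp_norm p x"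
proof (cases p)
  case (real r)
  with assms have r: "r \<ge> 1"
    by simp
  have "(\<Sum>i\<in>UNIV. \<bar>(c *\<^sub>R x) $ i\<bar> powr r) = \<bar>c\<bar> powr r * (\<Sum>i\<in>UNIV. \<bar>x $ i\<bar> powr r)"
    by (simp add: abs_mult powr_mult sum_distrib_left)
  moreover have "(\<bar>c\<bar> powr r * (\<Sum>i\<in>UNIV. \<bar>x $ i\<bar> powr r)) powr (1 / r) =
      \<bar>c\<bar> * (\<Sum>i\<in>UNIV. \<bar>x $ i\<bar> powr r) powr (1 / r)"
    using r by (subst powr_mult) (auto simp: powr_powr sum_nonneg)
  ultimately show ?thesis
    using real by (simp add: lp_norm_def)
next
  case PInf
  then show ?thesis
    by (simp add: lp_norm_def infnorm_mul)
next
  case MInf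
  with assms show ?thesis
    by simp
qed

lemma lp_norm_zero [simp]: "1 \<le> p \<Longrightarrow> lp_norm p 0 = 0"
  using lp_norm_scaleR[of p 0 0] by simp

lemma lp_norm_powr:
  assumes "1 \<le> r"
  shows "lp_norm (ereal r) x powr r = (\<Sum>i\<in>UNIV. \<bar>x $ i\<bar> powr r)"
  using assms by (simp add: lp_norm_def powr_powr sum_nonneg)


section \<open>Strict convexity of powers\<close>

text \<open>Away from 0 the function agrees locally with \<open>x powr r\<close> or
  \<open>(- x) powr r\<close>. At 0 the difference quotient is bounded by
  \<open>\<bar>h\<bar> powr (r - 1)\<close>, which tends to 0 because \<open>r > 1\<close>.\<close>

lemma abs_powr_has_derivative:
  fixes x r :: real
  assumes "1 < r"
  shows "((\<lambda>x. \<bar>x\<bar> powr r) has_real_derivative r * (sgn x * \<bar>x\<bar> powr (r - 1))) (at x)"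
proof -
  consider "0 < x" | "x < 0" | "x = 0"
    by linarith
  then show ?thesis
  proof cases
    case 1
    then have "((\<lambda>x. x powr r) has_real_derivative r * (sgn x * \<bar>x\<bar> powr (r - 1))) (at x)"
      using has_real_derivative_powr[of x r] by simp
    then show ?thesis
      by (rule DERIV_cong_ev[THEN iffD1, rotated -1])
        (auto intro!: eventually_mono[OF eventually_nhds_in_open[of "{0<..}"]] simp: 1)
  next
    case 2
    then have "((\<lambda>x. (- x) powr r) has_real_derivative r * (sgn x * \<bar>x\<bar> powr (r - 1))) (at x)"
      by (auto intro!: derivative_eq_intros)
    then show ?thesis
      by (rule DERIV_cong_ev[THEN iffD1, rotated -1])
        (auto intro!: eventually_mono[OF eventually_nhds_in_open[of "{..<0}"]] simp: 2)
  next
    case 3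
    have "((\<lambda>h. \<bar>h::real\<bar> powr (r - 1)) \<longlongrightarrow> \<bar>0\<bar> powr (r - 1)) (at 0)"
      using assms by (intro tendsto_intros) auto
    then have "((\<lambda>h. \<bar>h::real\<bar> powr (r - 1)) \<longlongrightarrow> 0) (at 0)"
      by simp
    moreover have "norm (\<bar>h\<bar> powr r / h) \<le> \<bar>h\<bar> powr (r - 1)" for h :: real
      by (simp add: powr_diff)
    ultimately have "((\<lambda>h::real. \<bar>h\<bar> powr r / h) \<longlongrightarrow> 0) (at 0)"
      by (rule Lim_null_comparison[OF always_eventually[OF allI], rotated])
    then show ?thesis
      using 3 by (simp add: DERIV_def)
  qed
qed

text \<open>Up to a constant factor this is the derivative of
  \<open>\<bar>x\<bar> powr (s + 1)\<close>; its strict growth is the source of strict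
  convexity.\<close>

lemma sgn_abs_powr_strict_mono:
  fixes x y s :: real
  assumes "0 < s" "x < y"
  shows "sgn x * \<bar>x\<bar> powr s < sgn y * \<bar>y\<bar> powr s"
proof -
  consider "0 \<le> x" | "x < 0" "0 \<le> y" | "y < 0"
    by linarith
  then show ?thesis
  proof cases
    case 1
    then show ?thesis
      using assms powr_less_mono2[of s x y] by (cases "x = 0") auto
  next
    case 2
    then have "sgn x * \<bar>x\<bar> powr s < 0"
      by simp
    also have "0 \<le> sgn y * \<bar>y\<bar> powr s"
      using 2 by simp
    finally show ?thesis .
  next
    case 3
    then show ?thesis
      using assms powr_less_mono2[of s "- y" "- x"] by auto
  qed
qed

text \<open>The mean value theorem supplies a slope \<open>f' y\<close> with \<open>y\<close>
  strictly between \<open>a\<close> and \<open>x\<close>. It exceeds \<open>f' a\<close> when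
  \<open>a < x\<close> and lies below it when \<open>x < a\<close>; multiplied by
  \<open>x - a\<close>, both cases favour \<open>f x\<close>.\<close>

lemma tangent_less_if_strict_mono_deriv:
  fixes f f' :: "real \<Rightarrow> real"
  assumes deriv: "\<And>y. (f has_real_derivative f' y) (at y)"
    and mono: "\<And>y z. y < z \<Longrightarrow> f' y < f' z"
    and "x \<noteq> a"
  shows "f a + f' a * (x - a) < f x"
proof (cases "a < x")
  case True
  then obtain y where y: "a < y" "y < x" "f x - f a = (x - a) * f' y"
    using MVT2[OF True deriv] by blast
  have "(x - a) * f' a < (x - a) * f' y"
    using True y mono by (intro mult_strict_left_mono) auto
  with y(3) show ?thesis
    by (simp only: mult.commute[of "f' a"])
next
  case False
  with assms have *: "x < a"
    by simp
  obtain y where y: "x < y" "y < a" "f a - f x = (a - x) * f' y"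
    using MVT2[OF * deriv] by blast
  have "(a - x) * f' y < (a - x) * f' a"
    using * y mono by (intro mult_strict_left_mono) auto
  with y(3) have "f a - f x < (a - x) * f' a"
    by simp
  then show ?thesis
    by (simp add: algebra_simps)
qed

lemma abs_powr_tangent_less:
  fixes x a r :: real
  assumes "1 < r" "x \<noteq> a"
  shows "\<bar>a\<bar> powr r + r * (sgn a * \<bar>a\<bar> powr (r - 1)) * (x - a) < \<bar>x\<bar> powr r"
proof (rule tangent_less_if_strict_mono_deriv[of "\<lambda>x. \<bar>x\<bar> powr r"])
  show "r * (sgn y * \<bar>y\<bar> powr (r - 1)) < r * (sgn z * \<bar>z\<bar> powr (r - 1))" if "y < z" for y z
    using assms that by (intro mult_strict_left_mono sgn_abs_powr_strict_mono) auto
qed (use assms in \<open>auto intro: abs_powr_has_derivative\<close>)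

text \<open>Take the tangent at the convex combination \<open>c\<close>. Both \<open>a\<close> and
  \<open>b\<close> differ from \<open>c\<close>, so both tangent inequalities are strict, and in
  their weighted sum the linear terms cancel.\<close>

lemma abs_powr_convex_less:
  fixes a b t r :: real
  assumes "1 < r" "a \<noteq> b" "0 < t" "t < 1"
  shows "\<bar>t * a + (1 - t) * b\<bar> powr r < t * \<bar>a\<bar> powr r + (1 - t) * \<bar>b\<bar> powr r"
proof -
  define c where "c = t * a + (1 - t) * b"
  define k where "k = r * (sgn c * \<bar>c\<bar> powr (r - 1))"
  have ca: "a - c = (1 - t) * (a - b)" and cb: "b - c = - t * (a - b)"
    by (simp_all add: c_def algebra_simps)
  then have "a \<noteq> c" "b \<noteq> c"
    using assms by auto
  then have "t * (\<bar>c\<bar> powr r + k * (a - c)) + (1 - t) * (\<bar>c\<bar> powr r + k * (b - c)) <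
      t * \<bar>a\<bar> powr r + (1 - t) * \<bar>b\<bar> powr r"
    using assms abs_powr_tangent_less[OF assms(1), of _ c, folded k_def]
    by (intro add_strict_mono mult_strict_left_mono) auto
  moreover have "t * (\<bar>c\<bar> powr r + k * (a - c)) + (1 - t) * (\<bar>c\<bar> powr r + k * (b - c)) = \<bar>c\<bar> powr r"
    unfolding ca cb by (simp add: algebra_simps)
  ultimately show ?thesis
    by (simp add: c_def)
qed

lemma abs_powr_convex:
  fixes a b t r :: real
  assumes "1 \<le> r" "0 < t" "t < 1"
  shows "\<bar>t * a + (1 - t) * b\<bar> powr r \<le> t * \<bar>a\<bar> powr r + (1 - t) * \<bar>b\<bar> powr r"
proof -
  consider "r = 1" | "a = b" | "1 < r" "a \<noteq> b"
    using assms by linarith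
  then show ?thesis
  proof cases
    case 1
    then show ?thesis
      using assms abs_triangle_ineq[of "t * a" "(1 - t) * b"] by (simp add: abs_mult)
  next
    case 2
    then show ?thesis
      by (simp add: algebra_simps)
  next
    case 3
    then show ?thesis
      using abs_powr_convex_less[of r a b t] assms by simp
  qed
qed


section \<open>Minkowski's inequality and its equality case\<close>

text \<open>Convexity of the power is applied in each coordinate and summed. A single coordinate in
  which \<open>a\<close> and \<open>b\<close> differ already makes the sum strict.\<close>

lemma lp_norm_unit_ball_convex:
  assumes r: "1 \<le> r" and ab: "lp_norm (ereal r) a = 1" "lp_norm (ereal r) b = 1"
    and t: "0 < t" "t < 1"
  shows "lp_norm (ereal r) (t *\<^sub>R a + (1 - t) *\<^sub>R b) \<le> 1"
    and "1 < r \<Longrightarrow> a \<noteq> b \<Longrightarrow> lp_norm (ereal r) (t *\<^sub>R a + (1 - t) *\<^sub>R b) < 1"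
proof -
  let ?c = "t *\<^sub>R a + (1 - t) *\<^sub>R b"
  let ?S = "\<lambda>x. \<Sum>i\<in>UNIV. \<bar>x $ i\<bar> powr r"
  have S: "?S a = 1" "?S b = 1"
    using lp_norm_powr[OF r] ab by (metis powr_one_eq_one)+
  have eq: "(\<Sum>i\<in>UNIV. t * \<bar>a $ i\<bar> powr r + (1 - t) * \<bar>b $ i\<bar> powr r) = 1"
    using S by (simp add: sum.distrib flip: sum_distrib_left)
  have le: "\<bar>?c $ i\<bar> powr r \<le> t * \<bar>a $ i\<bar> powr r + (1 - t) * \<bar>b $ i\<bar> powr r" for i
    using abs_powr_convex[OF r t] by simp
  have "?S ?c \<le> (\<Sum>i\<in>UNIV. t * \<bar>a $ i\<bar> powr r + (1 - t) * \<bar>b $ i\<bar> powr r)"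
    by (intro sum_mono le)
  then have "?S ?c \<le> 1"
    by (simp only: eq)
  then have "?S ?c powr (1 / r) \<le> 1"
    using r by (intro powr_le1) (auto simp: sum_nonneg)
  then show "lp_norm (ereal r) ?c \<le> 1"
    by (simp add: lp_norm_def)
  assume *: "1 < r" "a \<noteq> b"
  then obtain i where "a $ i \<noteq> b $ i"
    by (auto simp: vec_eq_iff)
  then have "\<bar>?c $ i\<bar> powr r < t * \<bar>a $ i\<bar> powr r + (1 - t) * \<bar>b $ i\<bar> powr r"
    using abs_powr_convex_less[OF *(1) _ t] by simp
  then have "?S ?c < (\<Sum>i\<in>UNIV. t * \<bar>a $ i\<bar> powr r + (1 - t) * \<bar>b $ i\<bar> powr r)"
    using le by (intro sum_strict_mono_ex1) auto
  then have "?S ?c < 1"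
    by (simp only: eq)
  then have "?S ?c powr (1 / r) < 1 powr (1 / r)"
    using r by (intro powr_less_mono2) (auto simp: sum_nonneg)
  then show "lp_norm (ereal r) ?c < 1"
    by (simp add: lp_norm_def)
qed

text \<open>By homogeneity, \<open>x + y\<close> is \<open>?N x + ?N y\<close> times a convex
  combination of the normalized vectors, so convexity of the unit ball suffices. The
  cross-multiplied condition says that the normalized vectors differ.\<close>

lemma
  assumes r: "1 \<le> r" and xy: "x \<noteq> 0" "y \<noteq> 0"
  shows lp_norm_triangle_finite:
      "lp_norm (ereal r) (x + y) \<le> lp_norm (ereal r) x + lp_norm (ereal r) y"
    and lp_norm_triangle_less:
      "1 < r \<Longrightarrow> lp_norm (ereal r) y *\<^sub>R x \<noteq> lp_norm (ereal r) x *\<^sub>R y \<Longrightarrow>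
        lp_norm (ereal r) (x + y) < lp_norm (ereal r) x + lp_norm (ereal r) y"
proof -
  let ?N = "lp_norm (ereal r)"
  have r': "1 \<le> ereal r"
    using r by simp
  have pos: "?N x > 0" "?N y > 0"
    using lp_norm_pos[OF r'] xy by auto
  define a b t where "a = x /\<^sub>R ?N x" and "b = y /\<^sub>R ?N y" and "t = ?N x / (?N x + ?N y)"
  have ab: "?N a = 1" "?N b = 1"
    using pos by (auto simp: a_def b_def lp_norm_scaleR[OF r'])
  have t: "0 < t" "t < 1" "1 - t = ?N y / (?N x + ?N y)"
    using pos by (auto simp: t_def field_simps)
  have "(?N x + ?N y) *\<^sub>R (t *\<^sub>R a + (1 - t) *\<^sub>R b) = x + y"
    unfolding t(3) using pos by (simp add: t_def a_def b_def scaleR_add_right)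
  then have eq: "?N (x + y) = (?N x + ?N y) * ?N (t *\<^sub>R a + (1 - t) *\<^sub>R b)"
    using lp_norm_scaleR[OF r', of "?N x + ?N y"] pos by (metis abs_of_pos add_pos_pos)
  show "?N (x + y) \<le> ?N x + ?N y"
    unfolding eq using lp_norm_unit_ball_convex(1)[OF r ab t(1,2)] pos
    by (simp add: mult_le_cancel_left1)
  assume *: "1 < r" "?N y *\<^sub>R x \<noteq> ?N x *\<^sub>R y"
  have "?N y *\<^sub>R x = (?N x * ?N y) *\<^sub>R a" "?N x *\<^sub>R y = (?N x * ?N y) *\<^sub>R b"
    using pos by (simp_all add: a_def b_def)
  with * have "a \<noteq> b"
    by metis
  then show "?N (x + y) < ?N x + ?N y"
    unfolding eq using lp_norm_unit_ball_convex(2)[OF r ab t(1,2) *(1)] pos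
    by (simp add: mult_less_cancel_left1)
qed

lemma lp_norm_triangle:
  assumes "1 \<le> p"
  shows "lp_norm p (x + y) \<le> lp_norm p x + lp_norm p y"
proof (cases "x = 0 \<or> y = 0")
  case True
  then show ?thesis
    using assms by auto
next
  case False
  then show ?thesis
    using assms lp_norm_triangle_finite infnorm_triangle
    by (cases p) (auto simp: lp_norm_def[of \<infinity>])
qed

section \<open>The sharp comparison constant and the gradient of the l_p norm\<close>

lemma lp_norm_le_ratio:
  fixes x :: "real ^ 'm"
  assumes "1 \<le> a" "1 \<le> b"
  shows "lp_norm a x \<le> lp_ratio TYPE('m) a b * lp_norm b x"
proof (cases "x = 0")
  case True
  then show ?thesis
    using assms by simp
next
  case False
  then have pos: "lp_norm b x > 0"
    using assms lp_norm_pos by blast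
  obtain u :: "real ^ 'm" where u: "lp_ratio TYPE('m) a b = lp_norm a u"
    "\<And>v :: real ^ 'm. lp_norm b v = 1 \<Longrightarrow> lp_norm a v \<le> lp_norm a u"
    by (rule lp_ratio_attained[OF assms]) auto
  have "lp_norm b (x /\<^sub>R lp_norm b x) = 1"
    using pos assms by (simp add: lp_norm_scaleR)
  from u(2)[OF this] show ?thesis
    using pos assms u(1) by (simp add: lp_norm_scaleR field_simps)
qed

lemma lp_ratio_pos:
  assumes "1 \<le> a" "1 \<le> b"
  shows "0 < lp_ratio TYPE('m::finite) a b"
proof -
  obtain u :: "real ^ 'm" where u: "lp_norm b u = 1" "lp_ratio TYPE('m) a b = lp_norm a u"
    by (rule lp_ratio_attained[OF assms]) auto
  then have "u \<noteq> 0"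
    using assms by auto
  then show ?thesis
    using u assms by (simp add: lp_norm_pos)
qed

text \<open>Chain rule through the power sum S, which equals the r-th power of the norm and is
  positive since \<open>x \<noteq> 0\<close>; hence S to the power \<open>1 / r - 1\<close> is the
  norm to the power \<open>1 - r\<close>.\<close>

lemma lp_norm_has_derivative:
  fixes x :: "real ^ 'm"
  assumes r: "1 < r" and x: "x \<noteq> 0"
  shows "(lp_norm (ereal r) has_derivative
    (\<lambda>h. lp_norm (ereal r) x powr (1 - r) *
      (\<Sum>i\<in>UNIV. sgn (x $ i) * \<bar>x $ i\<bar> powr (r - 1) * h $ i))) (at x)"
proof -
  let ?S = "\<lambda>x :: real ^ 'm. \<Sum>i\<in>UNIV. \<bar>x $ i\<bar> powr r"
  let ?D = "\<lambda>h. \<Sum>i\<in>UNIV. sgn (x $ i) * \<bar>x $ i\<bar> powr (r - 1) * h $ i"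
  have S: "?S x = lp_norm (ereal r) x powr r"
    using r by (simp add: lp_norm_powr)
  have pos: "lp_norm (ereal r) x > 0"
    using r x by (intro lp_norm_pos) auto
  then have Spos: "?S x > 0"
    by (simp add: S)
  have "((\<lambda>x :: real ^ 'm. \<bar>x $ i\<bar> powr r) has_derivative
      (\<lambda>h. r * (sgn (x $ i) * \<bar>x $ i\<bar> powr (r - 1)) * h $ i)) (at x)" for i
    by (rule has_derivative_compose[OF bounded_linear_imp_has_derivative[OF bounded_linear_vec_nth]
        abs_powr_has_derivative[OF r, THEN has_field_derivative_imp_has_derivative]])
  then have "(?S has_derivative (\<lambda>h. \<Sum>i\<in>UNIV. r * (sgn (x $ i) * \<bar>x $ i\<bar> powr (r - 1)) * h $ i)) (at x)"
    by (intro has_derivative_sum)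
  then have "(?S has_derivative (\<lambda>h. r * ?D h)) (at x)"
    by (simp add: sum_distrib_left mult.assoc)
  from has_derivative_compose[OF this
      has_real_derivative_powr[OF Spos, of "1 / r", THEN has_field_derivative_imp_has_derivative]]
  have "((\<lambda>x. ?S x powr (1 / r)) has_derivative
      (\<lambda>h. 1 / r * ?S x powr (1 / r - 1) * (r * ?D h))) (at x)" .
  moreover have "?S x powr (1 / r - 1) = lp_norm (ereal r) x powr (1 - r)"
    unfolding S powr_powr using r by (simp add: algebra_simps)
  ultimately show ?thesis
    using r by (simp add: lp_norm_def[abs_def])
qed


section \<open>The image of a vector under a Schatten ball\<close>

text \<open>The operator norm \<open>K\<close> of \<open>D\<close> is itself a singular value: a unit vector \<open>u\<close> with
  \<open>\<parallel>D u\<parallel> = K\<close> satisfies \<open>\<parallel>D\<^sup>T D u - K\<^sup>2 u\<parallel>\<^sup>2 \<le> 0\<close>.\<close>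

lemma norm_matrix_le_schatten_norm:
  fixes D :: "real ^ 'n ^ 'm"
  assumes "1 \<le> q"
  shows "norm (D *v x) \<le> schatten_norm q D * norm x"
proof -
  have "continuous_on (sphere 0 1) (\<lambda>x. norm (D *v x))"
    by (intro continuous_intros linear_continuous_on linear_conv_bounded_linear[THEN iffD1]
        matrix_vector_mul_linear)
  moreover have "axis undefined 1 \<in> sphere (0 :: real ^ 'n) 1"
    by (simp add: norm_axis_1)
  ultimately obtain u where u: "norm u = 1" and
    max: "\<And>x. norm x = 1 \<Longrightarrow> norm (D *v x) \<le> norm (D *v u)"
    using continuous_attains_sup[of "sphere 0 1" "\<lambda>x. norm (D *v x)"] by auto
  define K where "K = norm (D *v u)"
  have le: "norm (D *v x) \<le> K * norm x" for x
  proof (cases "x = 0")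
    case False
    then have "norm (D *v (x /\<^sub>R norm x)) \<le> K"
      unfolding K_def by (intro max) simp
    then show ?thesis
      using False by (simp add: matrix_vector_mult_scaleR field_simps)
  qed simp
  \<comment> \<open>\<open>y v* D\<close> is the transpose of \<open>D\<close> applied to
    \<open>y\<close>. The bound \<open>K\<close> passes to the transpose by moving \<open>D\<close>
    across the inner product and applying Cauchy-Schwarz.\<close>
  have le': "norm (y v* D) \<le> K * norm y" for y
  proof -
    let ?w = "y v* D"
    have "norm ?w * norm ?w = y \<bullet> (D *v ?w)"
      using dot_lmul_matrix[of y D ?w] by (simp add: dot_square_norm power2_eq_square)
    also have "\<dots> \<le> norm y * norm (D *v ?w)"
      by (rule norm_cauchy_schwarz)
    also have "\<dots> \<le> norm y * (K * norm ?w)"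
      by (intro mult_left_mono le) auto
    finally have "norm ?w * norm ?w \<le> (K * norm y) * norm ?w"
      by (simp add: mult_ac)
    then show ?thesis
      by (cases "norm ?w = 0") (auto simp: K_def)
  qed
  let ?w = "(D *v u) v* D"
  have "norm ?w \<le> K\<^sup>2"
    using le'[of "D *v u"] by (simp add: K_def power2_eq_square)
  then have "(norm ?w)\<^sup>2 \<le> (K\<^sup>2)\<^sup>2"
    by (intro power_mono) auto
  moreover have "?w \<bullet> u = K\<^sup>2"
    by (simp add: dot_lmul_matrix dot_square_norm K_def)
  then have "(norm (?w - K\<^sup>2 *\<^sub>R u))\<^sup>2 = (norm ?w)\<^sup>2 - (K\<^sup>2)\<^sup>2"
    using u norm_eq_1[of u] unfolding power2_norm_eq_inner
    by (simp add: inner_diff_left inner_diff_right inner_commute[of u ?w] power2_eq_square)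
  ultimately have "(norm (?w - K\<^sup>2 *\<^sub>R u))\<^sup>2 \<le> 0"
    by simp
  then have "(transpose D ** D) *v u = K\<^sup>2 *\<^sub>R u"
    by (simp flip: matrix_vector_mul_assoc)
  moreover have "u \<noteq> 0"
    using u by auto
  ultimately have "dim {v. (transpose D ** D) *v v = K\<^sup>2 *\<^sub>R v} \<noteq> 0"
    unfolding dim_eq_0 by blast
  moreover have "K \<ge> 0"
    by (simp add: K_def)
  \<comment> \<open>The multiplicity condition at \<open>t = K\<close> turns a nontrivial eigenspace
    into an index carrying the value \<open>K\<close>.\<close>
  ultimately have "card {j. singular_values D $ j = K} \<noteq> 0"
    using is_singular_values_singular_values[of D] unfolding is_singular_values_def by metis
  then obtain j where "singular_values D $ j = K"
    by (metis (mono_tags, lifting) Collect_empty_eq card.empty)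
  then have "K \<le> schatten_norm q D"
    using component_le_lp_norm[OF assms, of "singular_values D" j]
    by (simp add: schatten_norm_def)
  then have "K * norm x \<le> schatten_norm q D * norm x"
    by (intro mult_right_mono) auto
  with le[of x] show ?thesis
    by linarith
qed

text \<open>Here \<open>D\<^sup>T D\<close> maps \<open>x\<close> to
  \<open>(norm u)\<^sup>2 * (v \<bullet> x)\<close> times \<open>v\<close>: it is a multiple of the
  projection onto the line of \<open>v\<close>. So \<open>norm u\<close> is the only possibly
  nonzero singular value, and every l_q norm returns it.\<close>

lemma schatten_norm_rank_one:
  fixes u :: "real ^ 'm" and v :: "real ^ 'n"
  assumes q: "1 \<le> q" and v: "norm v = 1"
  shows "schatten_norm q (\<chi> i j. u $ i * v $ j) = norm u"
proof -
  let ?D = "(\<chi> i j. u $ i * v $ j) :: real ^ 'n ^ 'm"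
  \<comment> \<open>An arbitrary position for that singular value, since the order of the entries is
    free.\<close>
  fix k :: 'n
  have vv: "v \<bullet> v = 1"
    using v by (simp add: dot_square_norm)
  have "?D *v x = (v \<bullet> x) *\<^sub>R u" for x
    by (simp add: vec_eq_iff matrix_vector_mult_def inner_vec_def sum_distrib_left mult_ac)
  moreover have "y v* ?D = (u \<bullet> y) *\<^sub>R v" for y
    by (simp add: vec_eq_iff vector_matrix_mult_def inner_vec_def sum_distrib_left mult_ac)
  ultimately have f: "(transpose ?D ** ?D) *v x = ((norm u)\<^sup>2 * (v \<bullet> x)) *\<^sub>R v" for x
    by (simp add: matrix_vector_mul_assoc[symmetric] power2_norm_eq_inner mult.commute)
  have "is_singular_values ?D (axis k (norm u))"
    unfolding is_singular_values_def f
  proof (intro conjI allI impI)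
    show "0 \<le> axis k (norm u) $ j" for j
      by (simp add: axis_def)
    fix t :: real
    assume t: "0 \<le> t"
    have card: "{j. axis k (norm u) $ j = t} =
        (if t = norm u then {k} else {}) \<union> (if t = 0 then UNIV - {k} else {})"
      by (auto simp: axis_def)
    let ?E = "{x. ((norm u)\<^sup>2 * (v \<bullet> x)) *\<^sub>R v = t\<^sup>2 *\<^sub>R x}"
    \<comment> \<open>Pairing the eigenvalue equation with \<open>v\<close>: an eigenvector not
      orthogonal to \<open>v\<close> must have \<open>t = norm u\<close>.\<close>
    have E: "t\<^sup>2 * (v \<bullet> x) = (norm u)\<^sup>2 * (v \<bullet> x)" if "x \<in> ?E" for x
    proof -
      have "v \<bullet> (((norm u)\<^sup>2 * (v \<bullet> x)) *\<^sub>R v) = v \<bullet> (t\<^sup>2 *\<^sub>R x)"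
        using that by simp
      then show ?thesis
        by (auto simp: vv)
    qed
    have v0: "v \<noteq> 0"
      using v by auto
    consider "t = 0" "u = 0" | "t = 0" "u \<noteq> 0" | "t \<noteq> 0" "t = norm u" | "t \<noteq> 0" "t \<noteq> norm u"
      by blast
    then show "card {j. axis k (norm u) $ j = t} = dim ?E"
    proof cases
      case 1
      then show ?thesis
        unfolding card by simp
    next
      case 2
      then have "?E = {x. v \<bullet> x = 0}"
        using v0 by auto
      then show ?thesis
        unfolding card using 2 v0 by (simp add: dim_hyperplane card_Diff_singleton)
    next
      case 3
      have "?E = span {v}"
      proof (intro set_eqI iffI)
        fix x assume "x \<in> ?E"
        then have "x = (v \<bullet> x) *\<^sub>R v"
          using 3 by (simp flip: scaleR_scaleR)
        then show "x \<in> span {v}"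
          by (metis span_base span_scale singletonI)
      next
        fix x assume "x \<in> span {v}"
        then obtain c where "x = c *\<^sub>R v"
          by (auto simp: span_singleton)
        then show "x \<in> ?E"
          using 3 by (simp add: vv)
      qed
      then show ?thesis
        unfolding card using 3 v0 by (simp add: dim_span_eq_card_independent)
    next
      case 4
      have "x = 0" if "x \<in> ?E" for x
      proof -
        have "t\<^sup>2 \<noteq> (norm u)\<^sup>2"
          using 4 t by (simp add: power2_eq_iff_nonneg)
        then have "v \<bullet> x = 0"
          using E[OF that] by auto
        with that 4 show ?thesis
          by simp
      qed
      then have "?E \<subseteq> {0}"
        by blast
      then have "dim ?E = 0"
        by (simp only: dim_eq_0)
      then show ?thesis
        unfolding card using 4 by simp
    qed
  qed
  then have "schatten_norm q ?D = lp_norm q (axis k (norm u))"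
    by (rule schatten_norm_eqI)
  also have "axis k (norm u) = norm u *\<^sub>R axis k 1"
    by (simp add: vec_eq_iff axis_def)
  finally show ?thesis
    using q by (simp add: lp_norm_scaleR lp_norm_axis)
qed

text \<open>One inclusion is the operator norm bound. For the other, the rank-one matrix with
  \<open>v\<close> along \<open>\<beta>\<close> and \<open>u\<close> a rescaled \<open>w\<close>
  sends \<open>\<beta>\<close> to \<open>w\<close>, and its Schatten norm does not depend on
  \<open>q\<close>.\<close>

lemma schatten_ball_image:
  fixes \<beta> :: "real ^ 'n"
  assumes q: "1 \<le> q" and lam: "0 \<le> lam"
  shows "(\<lambda>D. D *v \<beta>) ` (schatten_ball q lam :: (real ^ 'n ^ 'm) set) = cball 0 (lam * norm \<beta>)"
proof (intro set_eqI iffI)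
  fix w :: "real ^ 'm"
  assume "w \<in> (\<lambda>D. D *v \<beta>) ` (schatten_ball q lam :: (real ^ 'n ^ 'm) set)"
  then obtain D :: "real ^ 'n ^ 'm" where "schatten_norm q D \<le> lam" "w = D *v \<beta>"
    by (auto simp: schatten_ball_def)
  then show "w \<in> cball 0 (lam * norm \<beta>)"
    using norm_matrix_le_schatten_norm[OF q, of D \<beta>] mult_right_mono[of _ lam "norm \<beta>"]
    by fastforce
next
  fix w :: "real ^ 'm"
  assume w: "w \<in> cball 0 (lam * norm \<beta>)"
  obtain v :: "real ^ 'n" where v: "norm v = 1" "\<beta> = norm \<beta> *\<^sub>R v"
  proof (cases "\<beta> = 0")
    case True
    show ?thesis
      by (rule that[of "axis undefined 1"]) (simp_all add: True norm_axis_1)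
  next
    case False
    then show ?thesis
      by (intro that[of "\<beta> /\<^sub>R norm \<beta>"]) auto
  qed
  \<comment> \<open>For \<open>\<beta> = 0\<close> the convention \<open>inverse 0 = 0\<close> gives
    \<open>u = 0\<close>, and \<open>w = 0\<close> as well because the ball is a point.\<close>
  define u where "u = w /\<^sub>R norm \<beta>"
  let ?D = "(\<chi> i j. u $ i * v $ j) :: real ^ 'n ^ 'm"
  have "norm u \<le> lam"
    using w lam by (cases "\<beta> = 0") (auto simp: u_def field_simps)
  then have "?D \<in> schatten_ball q lam"
    by (simp add: schatten_ball_def schatten_norm_rank_one q v(1))
  moreover have "?D *v \<beta> = w"
  proof -
    have "?D *v \<beta> = (v \<bullet> \<beta>) *\<^sub>R u"
      by (simp add: vec_eq_iff matrix_vector_mult_def inner_vec_def sum_distrib_left mult_ac)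
    also have "v \<bullet> \<beta> = norm \<beta>"
      by (subst v(2)) (simp add: dot_square_norm v(1))
    also have "norm \<beta> *\<^sub>R u = w"
      using w by (cases "\<beta> = 0") (auto simp: u_def)
    finally show ?thesis .
  qed
  ultimately show "w \<in> (\<lambda>D. D *v \<beta>) ` schatten_ball q lam"
    by blast
qed

lemma worst_case_attained:
  fixes \<beta> :: "real ^ 'n" and z :: "real ^ 'm"
  assumes "1 \<le> p" "1 \<le> q" "0 \<le> lam"
  obtains w where "norm w \<le> lam * norm \<beta>" "worst_case p q lam z \<beta> = lp_norm p (z + w)"
    "\<And>w'. norm w' \<le> lam * norm \<beta> \<Longrightarrow> lp_norm p (z + w') \<le> lp_norm p (z + w)"
proof -
  let ?B = "cball 0 (lam * norm \<beta>) :: (real ^ 'm) set"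
  have "continuous_on ?B (\<lambda>w. lp_norm p (z + w))"
    by (rule continuous_on_compose2[OF continuous_lp_norm[OF assms(1)]]) (auto intro!: continuous_intros)
  moreover have "0 \<in> ?B"
    using assms by simp
  ultimately obtain w where w: "w \<in> ?B" "\<And>w'. w' \<in> ?B \<Longrightarrow> lp_norm p (z + w') \<le> lp_norm p (z + w)"
    using continuous_attains_sup[of ?B "\<lambda>w. lp_norm p (z + w)"] by auto
  have "worst_case p q lam z \<beta> =
      Sup ((\<lambda>w. lp_norm p (z + w)) ` (\<lambda>D. D *v \<beta>) ` (schatten_ball q lam :: (real ^ 'n ^ 'm) set))"
    by (simp add: worst_case_def image_image)
  also have "\<dots> = lp_norm p (z + w)"
    unfolding schatten_ball_image[OF assms(2,3)] using w by (intro cSup_eq_maximum) auto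
  finally show ?thesis
    using w by (intro that[of w]) auto
qed


section \<open>Extremal perturbations\<close>

lemma lp_norm_ereal_two: "lp_norm (ereal 2) x = norm x"
  using lp_norm_two[of x] by simp

lemma lp_norm_one_conv: "lp_norm 1 x = (\<Sum>i\<in>UNIV. \<bar>x $ i\<bar>)"
  by (simp add: lp_norm_def sum_nonneg)

lemma ex_norm_lp_norm_add_eq:
  fixes z :: "real ^ 'm"
  assumes p: "p \<in> {1, 2, \<infinity>}" and r: "0 \<le> r"
  obtains w where "norm w = r" "lp_norm p (z + w) = lp_norm p z + r * lp_ratio TYPE('m) p 2"
proof -
  have p1: "1 \<le> p" "1 \<le> (2 :: ereal)"
    using p by auto
  obtain u :: "real ^ 'm" where u: "norm u = 1" "lp_ratio TYPE('m) p 2 = lp_norm p u"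
    by (rule lp_ratio_attained[OF p1, where 'm = 'm]) (auto simp: lp_norm_ereal_two)
  have "\<exists>v :: real ^ 'm. norm v = 1 \<and> lp_norm p z + r * lp_norm p u \<le> lp_norm p (z + r *\<^sub>R v)"
  proof -
    consider "p = 1" | "p = 2" | "p = \<infinity>"
      using p by blast
    then show ?thesis
    proof cases
      case 1
      \<comment> \<open>Giving the entries of \<open>u\<close> the signs of \<open>z\<close> rules
        out cancellation and keeps both norms of \<open>u\<close>.\<close>
      define v :: "real ^ 'm" where "v = (\<chi> i. if z $ i < 0 then - \<bar>u $ i\<bar> else \<bar>u $ i\<bar>)"
      have "\<bar>v $ i\<bar> = \<bar>u $ i\<bar>" for i
        by (simp add: v_def)
      then have "norm v = norm u"
        by (simp add: norm_vec_def)
      moreover have "\<bar>(z + r *\<^sub>R v) $ i\<bar> = \<bar>z $ i\<bar> + r * \<bar>u $ i\<bar>" for i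
      proof -
        define c where "c = r * \<bar>u $ i\<bar>"
        have "c \<ge> 0"
          using r by (simp add: c_def)
        moreover have "(z + r *\<^sub>R v) $ i = (if z $ i < 0 then z $ i - c else z $ i + c)"
          by (simp add: v_def c_def)
        ultimately show ?thesis
          by (simp flip: c_def)
      qed
      ultimately show ?thesis
        using 1 u by (intro exI[of _ v]) (simp add: lp_norm_one_conv sum.distrib sum_distrib_left)
    next
      case 2
      show ?thesis
      proof (cases "z = 0")
        case True
        then show ?thesis
          using 2 u r by (intro exI[of _ u]) (simp add: lp_norm_ereal_two)
      next
        case False
        \<comment> \<open>For \<open>p = 2\<close> the constant is \<open>norm u = 1\<close>, and
          moving along \<open>z\<close> is optimal.\<close>
        have "z + r *\<^sub>R (z /\<^sub>R norm z) = (1 + r / norm z) *\<^sub>R z"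
          by (simp add: algebra_simps divide_inverse)
        then have "norm (z + r *\<^sub>R (z /\<^sub>R norm z)) = (1 + r / norm z) * norm z"
          using r by (simp only: norm_scaleR) simp
        also have "\<dots> = norm z + r"
          using False by (simp add: field_simps)
        finally show ?thesis
          using False 2 u by (intro exI[of _ "z /\<^sub>R norm z"]) (simp add: lp_norm_ereal_two)
      qed
    next
      case 3
      \<comment> \<open>For \<open>p = \<infinity>\<close> the whole step goes into a coordinate
        where \<open>z\<close> is largest in modulus; the constant is at most 1.\<close>
      have "Max (range (\<lambda>i. \<bar>z $ i\<bar>)) \<in> range (\<lambda>i. \<bar>z $ i\<bar>)"
        by (rule Max_in) auto
      then obtain i where i: "lp_norm \<infinity> z = \<bar>z $ i\<bar>"
        unfolding lp_norm_infinity by blast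
      have "\<bar>u $ j\<bar> \<le> 1" for j
        using component_le_norm_cart[of u j] u by simp
      then have "lp_norm \<infinity> u \<le> 1"
        by (simp add: lp_norm_infinity)
      then have le: "lp_norm \<infinity> z + r * lp_norm \<infinity> u \<le> \<bar>z $ i\<bar> + r"
        using mult_left_mono[OF _ r, of "lp_norm \<infinity> u" 1] i by simp
      \<comment> \<open>Unlike \<open>sgn\<close>, this is 1 at zero, so the direction remains a
        unit vector.\<close>
      define s :: real where "s = (if z $ i < 0 then - 1 else 1)"
      have "\<bar>z $ i\<bar> + r = \<bar>(z + r *\<^sub>R (s *\<^sub>R axis i 1)) $ i\<bar>"
        using r by (simp add: s_def axis_def)
      also have "\<dots> \<le> lp_norm \<infinity> (z + r *\<^sub>R (s *\<^sub>R axis i 1))"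
        by (rule component_le_lp_norm) simp
      finally show ?thesis
        using 3 le by (intro exI[of _ "s *\<^sub>R axis i 1"]) (simp add: s_def)
    qed
  qed
  then obtain v :: "real ^ 'm" where v: "norm v = 1" "lp_norm p z + r * lp_norm p u \<le> lp_norm p (z + r *\<^sub>R v)"
    by blast
  \<comment> \<open>The three cases give one inequality; Minkowski and the maximality of
    \<open>u\<close> give the other.\<close>
  have "lp_norm p (z + r *\<^sub>R v) \<le> lp_norm p z + r * lp_norm p v"
    using lp_norm_triangle[OF p1(1), of z "r *\<^sub>R v"] p1 r by (simp add: lp_norm_scaleR)
  also have "\<dots> \<le> lp_norm p z + r * lp_norm p u"
    using lp_norm_le_ratio[OF p1, of v] v(1) u(2) r by (simp add: lp_norm_ereal_two mult_left_mono)
  finally show ?thesis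
    using that[of "r *\<^sub>R v"] v r u(2) by simp
qed

text \<open>At a maximizer of \<open>\<parallel>x\<parallel>\<^sub>r / \<parallel>x\<parallel>\<^sub>2\<close> the gradient of the \<open>\<ell>\<^sub>r\<close> norm is parallel to \<open>x\<close>.\<close>

lemma lp_ratio_maximizer_components:
  fixes x :: "real ^ 'm"
  assumes r: "1 < r" "r \<noteq> 2"
    and max: "lp_norm (ereal r) x = lp_ratio TYPE('m) (ereal r) 2 * norm x"
    and nz: "x $ i \<noteq> 0" "x $ j \<noteq> 0"
  shows "\<bar>x $ i\<bar> = \<bar>x $ j\<bar>"
proof -
  let ?N = "lp_norm (ereal r) :: real ^ 'm \<Rightarrow> real"
  let ?\<delta> = "lp_ratio TYPE('m) (ereal r) 2"
  have p1: "1 \<le> ereal r" "1 \<le> (2 :: ereal)"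
    using r by auto
  have x: "x \<noteq> 0"
    using nz by auto
  define G where "G h = (\<Sum>i\<in>UNIV. sgn (x $ i) * \<bar>x $ i\<bar> powr (r - 1) * h $ i)" for h
  have "((\<lambda>y. ?N y - ?\<delta> * norm y) has_derivative
      (\<lambda>h. ?N x powr (1 - r) * G h - ?\<delta> * (h \<bullet> sgn x))) (at x)"
    unfolding G_def
    by (intro has_derivative_diff lp_norm_has_derivative has_derivative_mult_right has_derivative_norm r x)
  moreover have "\<forall>y\<in>UNIV. ?N y - ?\<delta> * norm y \<le> ?N x - ?\<delta> * norm x"
    using lp_norm_le_ratio[OF p1, where 'm = 'm] max by (simp add: lp_norm_ereal_two)
  ultimately have D0: "(\<lambda>h. ?N x powr (1 - r) * G h - ?\<delta> * (h \<bullet> sgn x)) = (\<lambda>h. 0)"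
    by (intro differential_zero_maxmin[of x UNIV]) auto
  \<comment> \<open>Evaluating the vanishing derivative on \<open>axis k 1\<close> and cancelling
    \<open>x $ k\<close> leaves a right side free of \<open>k\<close>; \<open>r \<noteq> 2\<close>
    then allows the power to be inverted.\<close>
  have "\<bar>x $ k\<bar> powr (r - 2) = ?\<delta> * inverse (norm x) / ?N x powr (1 - r)" if "x $ k \<noteq> 0" for k
  proof -
    have "G (axis k 1) = (\<Sum>i\<in>UNIV. if i = k then sgn (x $ k) * \<bar>x $ k\<bar> powr (r - 1) else 0)"
      unfolding G_def by (intro sum.cong) (auto simp: axis_def)
    also have "\<dots> = x $ k * \<bar>x $ k\<bar> powr (r - 2)"
    proof -
      have "\<bar>x $ k\<bar> powr (r - 1) = \<bar>x $ k\<bar> powr (1 + (r - 2))"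
        by simp
      also have "\<dots> = \<bar>x $ k\<bar> * \<bar>x $ k\<bar> powr (r - 2)"
        using that by (subst powr_add) simp
      finally show ?thesis
        by (simp add: sgn_mult_abs mult.assoc[symmetric])
    qed
    finally have G: "G (axis k 1) = x $ k * \<bar>x $ k\<bar> powr (r - 2)" .
    have "axis k 1 \<bullet> sgn x = x $ k * inverse (norm x)"
      by (simp add: inner_axis' sgn_div_norm)
    then have "?N x powr (1 - r) * (x $ k * \<bar>x $ k\<bar> powr (r - 2)) = ?\<delta> * (x $ k * inverse (norm x))"
      using fun_cong[OF D0, of "axis k 1"] G by simp
    then have "x $ k * (?N x powr (1 - r) * \<bar>x $ k\<bar> powr (r - 2)) = x $ k * (?\<delta> * inverse (norm x))"
      by (simp only: mult_ac)
    then have "?N x powr (1 - r) * \<bar>x $ k\<bar> powr (r - 2) = ?\<delta> * inverse (norm x)"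
      using that by simp
    moreover have "?N x powr (1 - r) > 0"
      using lp_norm_pos[OF p1(1) x] by simp
    ultimately show ?thesis
      by (simp add: nonzero_eq_divide_eq mult.commute)
  qed
  then have "\<bar>x $ i\<bar> powr (r - 2) = \<bar>x $ j\<bar> powr (r - 2)"
    using nz by simp
  then have "(\<bar>x $ i\<bar> powr (r - 2)) powr (1 / (r - 2)) = (\<bar>x $ j\<bar> powr (r - 2)) powr (1 / (r - 2))"
    by simp
  then show ?thesis
    using r nz by (simp add: powr_powr)
qed

lemma AE_not_hyperplane:
  fixes a :: "real ^ 'm"
  assumes "a \<noteq> 0"
  shows "AE z in lebesgue. a \<bullet> z \<noteq> 0"
proof -
  have "negligible {z. a \<bullet> z = 0}"
    using assms by (intro negligible_hyperplane) auto
  then show ?thesis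
    unfolding negligible_iff_null_sets by (drule_tac AE_not_in) simp
qed

text \<open>Equality in the triangle inequality would force \<open>w\<close> to be parallel to \<open>z\<close>, which would make
  \<open>z\<close> a maximizer of \<open>\<parallel>x\<parallel>\<^sub>r / \<parallel>x\<parallel>\<^sub>2\<close>.\<close>

lemma lp_norm_add_less_ratio:
  fixes z w :: "real ^ 'm"
  assumes r: "1 < r" "r \<noteq> 2" and R: "0 < R" "norm w \<le> R"
    and z: "z $ i \<noteq> 0" "z $ j \<noteq> 0" "\<bar>z $ i\<bar> \<noteq> \<bar>z $ j\<bar>"
  shows "lp_norm (ereal r) (z + w) < lp_norm (ereal r) z + R * lp_ratio TYPE('m) (ereal r) 2"
proof (rule ccontr)
  let ?N = "lp_norm (ereal r) :: real ^ 'm \<Rightarrow> real"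
  let ?\<delta> = "lp_ratio TYPE('m) (ereal r) 2"
  have p1: "1 \<le> ereal r" "1 \<le> (2 :: ereal)"
    using r by auto
  have pos: "?\<delta> > 0"
    by (rule lp_ratio_pos[OF p1])
  assume "\<not> ?N (z + w) < ?N z + R * ?\<delta>"
  then have ge: "?N z + R * ?\<delta> \<le> ?N (z + w)"
    by simp
  have tri: "?N (z + w) \<le> ?N z + ?N w"
    by (rule lp_norm_triangle[OF p1(1)])
  have w_le: "?N w \<le> ?\<delta> * norm w"
    using lp_norm_le_ratio[OF p1, of w] by (simp add: lp_norm_ereal_two)
  have "?\<delta> * norm w \<le> R * ?\<delta>"
    using R pos by simp
  \<comment> \<open>The chain of estimates from \<open>?N (z + w)\<close> up to
    \<open>?N z + R * ?\<delta>\<close> closes on itself, so each link is an equality.\<close>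
  with ge tri w_le have eq: "?N (z + w) = ?N z + ?N w" "?N w = ?\<delta> * norm w" "?\<delta> * norm w = R * ?\<delta>"
    by linarith+
  have z0: "z \<noteq> 0" and w0: "w \<noteq> 0"
    using z eq(3) R pos by auto
  have par: "?N w *\<^sub>R z = ?N z *\<^sub>R w"
    using lp_norm_triangle_less[of r z w] r z0 w0 eq(1) by force
  have "?N w * norm z = ?N z * norm w"
    using arg_cong[OF par, of norm] lp_norm_nonneg[OF p1(1), of z] lp_norm_nonneg[OF p1(1), of w] by simp
  then have "?N z = ?\<delta> * norm z"
    using eq(2) w0 by simp
  from lp_ratio_maximizer_components[OF r this z(1,2)] z(3) show False
    by simp
qed

text \<open>At a maximizer \<open>u\<close> of \<open>\<parallel>x\<parallel>\<^sub>2 / \<parallel>x\<parallel>\<^sub>r\<close> the functions \<open>\<parallel>x\<parallel>\<^sub>r\<close> and \<open>\<parallel>x\<parallel>\<^sub>2 / \<delta>\<close> touch, hence have the same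
  gradient, which has Euclidean length \<open>1 / \<delta>\<close>.\<close>

lemma lp_norm_add_at_maximizer:
  assumes r: "1 < r"
  obtains u :: "real ^ 'm" where "u \<noteq> 0"
    "\<And>\<epsilon>. 0 < \<epsilon> \<Longrightarrow> \<exists>d>0. \<forall>h. norm h < d \<longrightarrow> lp_norm (ereal r) (u + h) \<le>
      lp_norm (ereal r) u + norm h / lp_ratio TYPE('m) 2 (ereal r) + \<epsilon> * norm h"
proof -
  let ?N = "lp_norm (ereal r) :: real ^ 'm \<Rightarrow> real"
  let ?\<delta> = "lp_ratio TYPE('m) 2 (ereal r)"
  have p1: "1 \<le> (2 :: ereal)" "1 \<le> ereal r"
    using r by auto
  have pos: "?\<delta> > 0"
    by (rule lp_ratio_pos[OF p1])
  obtain u :: "real ^ 'm" where u: "?N u = 1" "?\<delta> = norm u"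
    by (rule lp_ratio_attained[OF p1, where 'm = 'm]) (auto simp: lp_norm_ereal_two)
  have u0: "u \<noteq> 0"
    using u p1 by auto
  obtain N' where N': "(?N has_derivative N') (at u)"
    using lp_norm_has_derivative[OF r u0] by blast
  have "((\<lambda>y. ?N y - inverse ?\<delta> * norm y) has_derivative (\<lambda>h. N' h - inverse ?\<delta> * (h \<bullet> sgn u))) (at u)"
    by (intro has_derivative_diff N' has_derivative_mult_right has_derivative_norm u0)
  moreover have "\<forall>y\<in>UNIV. ?N u - inverse ?\<delta> * norm u \<le> ?N y - inverse ?\<delta> * norm y"
    using lp_norm_le_ratio[OF p1, where 'm = 'm] u pos by (simp add: lp_norm_ereal_two field_simps)
  ultimately have "(\<lambda>h. N' h - inverse ?\<delta> * (h \<bullet> sgn u)) = (\<lambda>h. 0)"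
    by (intro differential_zero_maxmin[of u UNIV]) auto
  then have N'_eq: "N' h = inverse ?\<delta> * (h \<bullet> sgn u)" for h
    by (simp add: fun_eq_iff)
  have N'_le: "N' h \<le> norm h / ?\<delta>" for h
    unfolding N'_eq using norm_cauchy_schwarz[of h "sgn u"] u0 pos
    by (simp add: norm_sgn divide_inverse mult.commute)
  show ?thesis
  proof (rule that[OF u0])
    fix \<epsilon> :: real
    assume "0 < \<epsilon>"
    then obtain d where d: "d > 0"
      "\<And>y. norm (y - u) < d \<Longrightarrow> norm (?N y - ?N u - N' (y - u)) \<le> \<epsilon> * norm (y - u)"
      using N' unfolding has_derivative_at_alt by blast
    have "?N (u + h) \<le> ?N u + norm h / ?\<delta> + \<epsilon> * norm h" if "norm h < d" for h
      using d(2)[of "u + h"] that N'_le[of h] by (simp add: abs_le_iff)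
    with d(1) show "\<exists>d>0. \<forall>h. norm h < d \<longrightarrow> ?N (u + h) \<le> ?N u + norm h / ?\<delta> + \<epsilon> * norm h"
      by blast
  qed
qed

text \<open>Along the ray of \<open>z\<close> the norm is additive, and a step \<open>w\<close> of
  Euclidean length \<open>R\<close> has l_p norm at least \<open>R / ?\<delta>\<close>. At
  \<open>z = 0\<close> any direction serves.\<close>

lemma ex_norm_lp_norm_add_ge:
  fixes z :: "real ^ 'm"
  assumes p: "1 \<le> p" and R: "0 \<le> R"
  obtains w where "norm w = R" "lp_norm p z + R / lp_ratio TYPE('m) 2 p \<le> lp_norm p (z + w)"
proof -
  let ?\<delta> = "lp_ratio TYPE('m) 2 p"
  have p2: "1 \<le> (2 :: ereal)"
    by simp
  have pos: "?\<delta> > 0"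
    by (rule lp_ratio_pos[OF p2 p])
  have ge: "norm x / ?\<delta> \<le> lp_norm p x" for x :: "real ^ 'm"
    using lp_norm_le_ratio[OF p2 p, of x] pos by (simp add: lp_norm_ereal_two field_simps)
  show ?thesis
  proof (cases "z = 0")
    case True
    have "norm (R *\<^sub>R axis undefined 1 :: real ^ 'm) = R"
      using R by simp
    then show ?thesis
      using ge[of "R *\<^sub>R axis undefined 1"] True p by (intro that[of "R *\<^sub>R axis undefined 1"]) auto
  next
    case False
    define w where "w = (R / norm z) *\<^sub>R z"
    have w: "norm w = R"
      using False R by (simp add: w_def)
    have "z + w = (1 + R / norm z) *\<^sub>R z"
      by (simp add: w_def algebra_simps)
    then have "lp_norm p (z + w) = (1 + R / norm z) * lp_norm p z"
      using R by (simp only: lp_norm_scaleR[OF p]) simp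
    also have "\<dots> = lp_norm p z + lp_norm p w"
      using R p by (simp add: w_def lp_norm_scaleR algebra_simps)
    finally show ?thesis
      using ge[of w] w by (intro that[of w]) auto
  qed
qed

text \<open>Far out on the ray of the maximizer \<open>u\<close>, at \<open>t *\<^sub>R u\<close>,
  homogeneity turns \<open>w\<close> into the small perturbation \<open>w /\<^sub>R t\<close> of
  \<open>u\<close>, where the first-order estimate applies.\<close>

lemma lp_norm_gap_small:
  assumes r: "1 < r" and R: "0 \<le> R" and e: "0 < e"
  obtains z :: "real ^ 'm" where "\<And>w. norm w \<le> R \<Longrightarrow>
    lp_norm (ereal r) (z + w) \<le> lp_norm (ereal r) z + R / lp_ratio TYPE('m) 2 (ereal r) + e"
proof -
  let ?N = "lp_norm (ereal r) :: real ^ 'm \<Rightarrow> real"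
  let ?\<delta> = "lp_ratio TYPE('m) 2 (ereal r)"
  have p1: "1 \<le> (2 :: ereal)" "1 \<le> ereal r"
    using r by auto
  have pos: "?\<delta> > 0"
    by (rule lp_ratio_pos[OF p1])
  \<comment> \<open>Using \<open>R + 1\<close> here and in \<open>t\<close> covers
    \<open>R = 0\<close> and makes \<open>R / t < d\<close> strict.\<close>
  define \<epsilon> where "\<epsilon> = e / (R + 1)"
  have \<epsilon>: "\<epsilon> > 0" "\<epsilon> * R \<le> e"
    using e R by (auto simp: \<epsilon>_def field_simps)
  obtain u :: "real ^ 'm" and d where d: "d > 0"
    "\<And>h. norm h < d \<Longrightarrow> ?N (u + h) \<le> ?N u + norm h / ?\<delta> + \<epsilon> * norm h"
    using lp_norm_add_at_maximizer[OF r, where 'm = 'm] \<epsilon>(1) by metis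
  define t where "t = (R + 1) / d"
  have t: "t > 0" "R / t < d"
    using d R by (auto simp: t_def field_simps)
  show ?thesis
  proof (rule that[of "t *\<^sub>R u"])
    fix w :: "real ^ 'm"
    assume w: "norm w \<le> R"
    have "norm (w /\<^sub>R t) \<le> R / t"
      using w t by (simp add: field_simps)
    then have *: "?N (u + w /\<^sub>R t) \<le> ?N u + norm (w /\<^sub>R t) / ?\<delta> + \<epsilon> * norm (w /\<^sub>R t)"
      using t by (intro d(2)) simp
    have "t *\<^sub>R u + w = t *\<^sub>R (u + w /\<^sub>R t)"
      using t by (simp add: scaleR_add_right)
    then have "?N (t *\<^sub>R u + w) = t * ?N (u + w /\<^sub>R t)"
      using t by (simp only: lp_norm_scaleR[OF p1(2)])
    also have "\<dots> \<le> t * (?N u + norm (w /\<^sub>R t) / ?\<delta> + \<epsilon> * norm (w /\<^sub>R t))"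
      using * t by (intro mult_left_mono) auto
    \<comment> \<open>The factor \<open>t\<close> cancels in the error term, which therefore stays
      below \<open>e\<close> however far out the point lies.\<close>
    also have "\<dots> = ?N (t *\<^sub>R u) + norm w / ?\<delta> + \<epsilon> * norm w"
      using t by (simp add: lp_norm_scaleR[OF p1(2)] field_simps)
    also have "\<dots> \<le> ?N (t *\<^sub>R u) + R / ?\<delta> + e"
      using w \<epsilon> pos order_trans[OF mult_left_mono[OF w, of \<epsilon>] \<epsilon>(2)]
      by (intro add_mono divide_right_mono) auto
    finally show "?N (t *\<^sub>R u + w) \<le> ?N (t *\<^sub>R u) + R / ?\<delta> + e" .
  qed
qed

section \<open>The maximum, both bounds, equality and strictness, and the vanishing gap\<close>

theorem proposition3:
  fixes p q :: ereal and lam :: real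
  assumes "0 < lam" and "1 \<le> p" and "1 \<le> q"
  shows
    (* the supremum defining worst_case is a maximum *)
    "(\<forall>(z :: real ^ 'm) (\<beta> :: real ^ 'n).
        \<exists>D \<in> (schatten_ball q lam :: (real ^ 'n ^ 'm) set).
          worst_case p q lam z \<beta> = lp_norm p (z + D *v \<beta>) \<and>
          (\<forall>D' \<in> schatten_ball q lam. lp_norm p (z + D' *v \<beta>) \<le> lp_norm p (z + D *v \<beta>)))
   \<and> (\<forall>(z :: real ^ 'm) (\<beta> :: real ^ 'n).
        worst_case p q lam z \<beta> \<le> lp_norm p z + lam * lp_ratio TYPE('m) p 2 * lp_norm 2 \<beta>)
   \<and> (p \<in> {1, 2, \<infinity>} \<longrightarrow>
        (\<forall>(z :: real ^ 'm) (\<beta> :: real ^ 'n).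
          worst_case p q lam z \<beta> = lp_norm p z + lam * lp_ratio TYPE('m) p 2 * lp_norm 2 \<beta>))
   \<and> (p \<notin> {1, 2, \<infinity>} \<and> 2 \<le> CARD('m) \<longrightarrow>
        (\<forall>\<beta> :: real ^ 'n. \<beta> \<noteq> 0 \<longrightarrow>
          (AE z :: real ^ 'm in lebesgue.
            worst_case p q lam z \<beta> < lp_norm p z + lam * lp_ratio TYPE('m) p 2 * lp_norm 2 \<beta>)))
   \<and> (p \<notin> {1, 2, \<infinity>} \<longrightarrow>
        (\<forall>(z :: real ^ 'm) (\<beta> :: real ^ 'n).
          lp_norm p z + lam / lp_ratio TYPE('m) 2 p * lp_norm 2 \<beta> \<le> worst_case p q lam z \<beta>)
        \<and> (\<forall>\<beta> :: real ^ 'n.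
          (INF z :: real ^ 'm. worst_case p q lam z \<beta>
             - (lp_norm p z + lam / lp_ratio TYPE('m) 2 p * lp_norm 2 \<beta>)) = 0))"
proof -
  have lam: "0 \<le> lam"
    using assms by simp
  have p2: "1 \<le> (2 :: ereal)"
    by simp
  let ?\<delta> = "lp_ratio TYPE('m) p 2" and ?\<delta>' = "lp_ratio TYPE('m) 2 p"
  note attained = worst_case_attained[OF assms(2,3) lam]
  have worst_ge: "lp_norm p (z + w) \<le> worst_case p q lam z \<beta>"
    if "norm w \<le> lam * norm \<beta>" for z w :: "real ^ 'm" and \<beta> :: "real ^ 'n"
    by (rule attained[of \<beta> z]) (use that in auto)
  \<comment> \<open>A maximal displacement \<open>w\<close> in the Euclidean ball is lifted to a
    matrix through \<open>schatten_ball_image\<close>.\<close>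
  have maximum: "\<exists>D \<in> (schatten_ball q lam :: (real ^ 'n ^ 'm) set).
      worst_case p q lam z \<beta> = lp_norm p (z + D *v \<beta>) \<and>
      (\<forall>D' \<in> schatten_ball q lam. lp_norm p (z + D' *v \<beta>) \<le> lp_norm p (z + D *v \<beta>))"
    for z :: "real ^ 'm" and \<beta> :: "real ^ 'n"
  proof -
    note image = schatten_ball_image[OF assms(3) lam, of \<beta>, where 'm = 'm]
    obtain w :: "real ^ 'm" where w: "norm w \<le> lam * norm \<beta>" "worst_case p q lam z \<beta> = lp_norm p (z + w)"
      by (rule attained[of \<beta> z]) auto
    then have "w \<in> (\<lambda>D. D *v \<beta>) ` schatten_ball q lam"
      unfolding image by simp
    then obtain D :: "real ^ 'n ^ 'm" where D: "D \<in> schatten_ball q lam" "w = D *v \<beta>"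
      by blast
    have "lp_norm p (z + D' *v \<beta>) \<le> lp_norm p (z + D *v \<beta>)"
      if "D' \<in> schatten_ball q lam" for D' :: "real ^ 'n ^ 'm"
    proof -
      have "D' *v \<beta> \<in> cball 0 (lam * norm \<beta>)"
        using that unfolding image[symmetric] by blast
      then show ?thesis
        using worst_ge[of "D' *v \<beta>" \<beta> z] w(2) D(2) by simp
    qed
    with w D show ?thesis
      by blast
  qed
  have upper: "worst_case p q lam z \<beta> \<le> lp_norm p z + lam * ?\<delta> * lp_norm 2 \<beta>"
    for z :: "real ^ 'm" and \<beta> :: "real ^ 'n"
  proof -
    obtain w :: "real ^ 'm" where w: "norm w \<le> lam * norm \<beta>" "worst_case p q lam z \<beta> = lp_norm p (z + w)"
      by (rule attained[of \<beta> z]) auto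
    have "lp_norm p (z + w) \<le> lp_norm p z + ?\<delta> * norm w"
      using lp_norm_triangle[OF assms(2), of z w] lp_norm_le_ratio[OF assms(2) p2, of w]
      unfolding lp_norm_two by linarith
    also have "?\<delta> * norm w \<le> ?\<delta> * (lam * norm \<beta>)"
      using w lp_ratio_pos[OF assms(2) p2, where 'm = 'm] by (intro mult_left_mono) auto
    finally show ?thesis
      unfolding w(2) lp_norm_two by (simp only: mult_ac)
  qed
  have equality: "worst_case p q lam z \<beta> = lp_norm p z + lam * ?\<delta> * lp_norm 2 \<beta>"
    if p: "p \<in> {1, 2, \<infinity>}" for z :: "real ^ 'm" and \<beta> :: "real ^ 'n"
  proof (rule antisym[OF upper])
    have R: "0 \<le> lam * norm \<beta>"
      using lam by simp
    obtain w :: "real ^ 'm" where "norm w = lam * norm \<beta>"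
      "lp_norm p (z + w) = lp_norm p z + lam * norm \<beta> * ?\<delta>"
      by (rule ex_norm_lp_norm_add_eq[OF p R])
    then show "lp_norm p z + lam * ?\<delta> * lp_norm 2 \<beta> \<le> worst_case p q lam z \<beta>"
      using worst_ge[of w \<beta> z] unfolding lp_norm_two by (simp add: mult_ac)
  qed
  have finite: "\<exists>r. p = ereal r \<and> 1 < r \<and> r \<noteq> 2" if "p \<notin> {1, 2, \<infinity>}"
    using that assms(2) by (cases p) (auto simp: one_ereal_def order_le_less)
  have strict: "AE z :: real ^ 'm in lebesgue.
      worst_case p q lam z \<beta> < lp_norm p z + lam * ?\<delta> * lp_norm 2 \<beta>"
    if p: "p \<notin> {1, 2, \<infinity>}" and m: "2 \<le> CARD('m)" and \<beta>: "\<beta> \<noteq> 0" for \<beta> :: "real ^ 'n"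
  proof -
    obtain r where r: "p = ereal r" "1 < r" "r \<noteq> 2"
      using finite[OF p] by blast
    obtain i j :: 'm where ij: "i \<noteq> j"
      using m card_le_Suc0_iff_eq[of "UNIV :: 'm set"] by fastforce
    have R: "0 < lam * norm \<beta>"
      using assms(1) \<beta> by simp
    \<comment> \<open>Four hyperplanes are avoided: two make the coordinates nonzero, and the other
      two make up the set where their moduli agree.\<close>
    have "axis i 1 - axis j 1 \<noteq> (0 :: real ^ 'm)" "axis i 1 + axis j 1 \<noteq> (0 :: real ^ 'm)"
      using ij by (auto simp: vec_eq_iff axis_def)
    then have "AE z :: real ^ 'm in lebesgue. axis i 1 \<bullet> z \<noteq> 0"
      "AE z :: real ^ 'm in lebesgue. axis j 1 \<bullet> z \<noteq> 0"
      "AE z :: real ^ 'm in lebesgue. (axis i 1 - axis j 1) \<bullet> z \<noteq> 0"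
      "AE z :: real ^ 'm in lebesgue. (axis i 1 + axis j 1) \<bullet> z \<noteq> 0"
      by (auto intro!: AE_not_hyperplane simp: axis_eq_0_iff)
    then show ?thesis
    proof eventually_elim
      case (elim z)
      then have z: "z $ i \<noteq> 0" "z $ j \<noteq> 0" "\<bar>z $ i\<bar> \<noteq> \<bar>z $ j\<bar>"
        by (auto simp: inner_axis' inner_diff_left inner_add_left abs_eq_iff)
      obtain w :: "real ^ 'm" where w: "norm w \<le> lam * norm \<beta>" "worst_case p q lam z \<beta> = lp_norm p (z + w)"
        by (rule attained[of \<beta> z]) auto
      from lp_norm_add_less_ratio[OF r(2,3) R w(1) z] show ?case
        unfolding w(2) lp_norm_two unfolding r(1) by (simp only: mult_ac)
    qed
  qed
  have lower: "lp_norm p z + lam / ?\<delta>' * lp_norm 2 \<beta> \<le> worst_case p q lam z \<beta>"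
    for z :: "real ^ 'm" and \<beta> :: "real ^ 'n"
  proof -
    have R: "0 \<le> lam * norm \<beta>"
      using lam by simp
    obtain w :: "real ^ 'm" where "norm w = lam * norm \<beta>"
      "lp_norm p z + lam * norm \<beta> / ?\<delta>' \<le> lp_norm p (z + w)"
      by (rule ex_norm_lp_norm_add_ge[OF assms(2) R])
    then show ?thesis
      using worst_ge[of w \<beta> z] unfolding lp_norm_two by simp
  qed
  have gap: "(INF z :: real ^ 'm. worst_case p q lam z \<beta>
      - (lp_norm p z + lam / ?\<delta>' * lp_norm 2 \<beta>)) = 0" (is "(INF z. ?g z) = 0")
    if p: "p \<notin> {1, 2, \<infinity>}" for \<beta> :: "real ^ 'n"
  proof (rule antisym)
    obtain r where r: "p = ereal r" "1 < r" "r \<noteq> 2"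
      using finite[OF p] by blast
    have nonneg: "0 \<le> ?g z" for z
      using lower[of z \<beta>] by simp
    then show "0 \<le> (INF z. ?g z)"
      by (intro cINF_greatest) auto
    show "(INF z. ?g z) \<le> 0"
    proof (rule field_le_epsilon)
      fix e :: real
      assume e: "0 < e"
      have "0 \<le> lam * norm \<beta>"
        using lam by simp
      from lp_norm_gap_small[OF r(2) this e]
      obtain z :: "real ^ 'm" where z: "\<And>w. norm w \<le> lam * norm \<beta> \<Longrightarrow>
          lp_norm p (z + w) \<le> lp_norm p z + lam * norm \<beta> / ?\<delta>' + e"
        unfolding r(1) by blast
      obtain w :: "real ^ 'm" where w: "norm w \<le> lam * norm \<beta>" "worst_case p q lam z \<beta> = lp_norm p (z + w)"
        by (rule attained[of \<beta> z]) auto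
      \<comment> \<open>The lower bound 0 on the gap supplies the boundedness that a real infimum
        requires.\<close>
      have "(INF z. ?g z) \<le> ?g z"
        by (intro cINF_lower bdd_belowI2[of _ 0] nonneg) auto
      also have "\<dots> \<le> e"
        using z[OF w(1)] unfolding w(2) lp_norm_two by simp
      finally show "(INF z. ?g z) \<le> 0 + e"
        by simp
    qed
  qed
  show ?thesis
    using maximum upper equality strict lower gap by blast
qed

end
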